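(* Suppose that the following statement (Q) holds: for every finite family $\mathcal{F}$ of finite sets, not necessarily distinct (i.e. a finite multiset of finite sets, not necessarily union-closed), with $|\mathcal{F}| > \left|\bigcup_{F\in\mathcal{F}}F\right|+1$, there exists a proper subfamily $\mathcal{F}'\subsetneq\mathcal{F}$ with $|\mathcal{F}|-|\mathcal{F}'| = \left|\bigcup_{F\in\mathcal{F}'}F\right|+1$. Then for every union-closed family $\mathcal{A}$ with base set $\bigcup_{A\in\mathcal{A}}A=[n]$ and every $x\in\left[\lfloor\tfrac{n}{2}\rfloor+1\right]$, there exists a subset $B\subseteq[n]$ with $|B|=n-x+1$ such that $|\mathcal{A}_B|\geq|\mathcal{A}_{\underline{B}}|$.
   Context: For a positive integer $m$, $[m]=\{1,2,\dots,m\}$. A family of sets $\mathcal{A}$ is union-closed if it is a finite nonempty collection of distinct finite sets, at least one of which is nonempty, such that $X,Y\in\mathcal{A}$ implies $X\cup Y\in\mathcal{A}$. The base set of $\mathcal{A}$ is $\bigcup_{A\in\mathcal{A}}A$, and it is taken to be $[n]$ (so $n\ge 1$). For a set $B\subseteq[n]$, $\mathcal{A}_B=\{A\in\mathcal{A} : A\cap B=B\}$ and $\mathcal{A}_{\underline{B}}=\{A\in\mathcal{A} : A\cap B=\emptyset\}$. In (Q), cardinalities $|\mathcal{F}|$, $|\mathcal{F}'|$ of families with possibly repeated members are counted with multiplicity, subfamilies are sub-multisets, and the union of the empty family is $\emptyset$. *)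

theory Defs
  imports Main "HOL-Library.Multiset"
begin

definition union_closed :: "'a set set \<Rightarrow> bool" where
  "union_closed \<A> \<longleftrightarrow>
     finite \<A> \<and> \<A> \<noteq> {} \<and> (\<forall>X\<in>\<A>. finite X) \<and> (\<exists>X\<in>\<A>. X \<noteq> {}) \<and>
     (\<forall>X\<in>\<A>. \<forall>Y\<in>\<A>. X \<union> Y \<in> \<A>)"

definition members_containing :: "'a set set \<Rightarrow> 'a set \<Rightarrow> 'a set set" where
  "members_containing \<A> B = {A \<in> \<A>. A \<inter> B = B}"

definition members_avoiding :: "'a set set \<Rightarrow> 'a set \<Rightarrow> 'a set set" where
  "members_avoiding \<A> B = {A \<in> \<A>. A \<inter> B = {}}"

(* Elements are taken from nat without loss of generality: only finitely many elements occur
   in a finite family of finite sets, so they can be renamed injectively to natural numbers. *)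
definition statement_Q :: bool where
  "statement_Q \<longleftrightarrow>
     (\<forall>\<F> :: nat set multiset.
        (\<forall>F \<in># \<F>. finite F) \<and> size \<F> > card (\<Union> (set_mset \<F>)) + 1 \<longrightarrow>
        (\<exists>\<F>'. \<F>' \<subset># \<F> \<and> size \<F> - size \<F>' = card (\<Union> (set_mset \<F>')) + 1))"

end

theory Submission
  imports Defs
begin

text \<open>
  Put \<open>k = n - x + 1\<close>. A \<open>k\<close>-set that meets every nonempty member of \<open>\<A>\<close> is avoided by at most
  the empty set and is contained in the member \<open>[n]\<close>. Otherwise the nonempty members have no transversal of
  size \<open>k\<close>; as adding a set raises the transversal number by at most one, some subfamily has
  transversal number exactly \<open>k + 1\<close>. In a minimum transversal \<open>S\<close> of it every \<open>t \<in> S\<close> has a private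
  member \<open>F t\<close> with \<open>F t \<inter> S = {t}\<close>. Applying (Q) to the sets \<open>F t - S\<close> gives \<open>S' \<subseteq> S\<close> such that
  \<open>B = (\<Union>t\<in>S'. F t)\<close>, whose trace on \<open>S\<close> is \<open>S'\<close>, has size \<open>k\<close>. Since \<open>B\<close> is a member,
  \<open>A \<mapsto> A \<union> B\<close> embeds the members avoiding \<open>B\<close> into those containing it.
\<close>

lemma critical_transversal:
  assumes "finite G" "\<forall>A\<in>G. A \<noteq> {}"
    and "\<nexists>T. finite T \<and> card T \<le> k \<and> (\<forall>A\<in>G. A \<inter> T \<noteq> {})"
  obtains S F where "finite S" "card S = k + 1" "\<forall>t\<in>S. F t \<in> G \<and> F t \<inter> S = {t}"
proof -
  have "\<exists>S F. finite S \<and> card S = k + 1 \<and> (\<forall>t\<in>S. F t \<in> G \<and> F t \<inter> S = {t})"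
    using assms
  proof (induction G rule: finite_induct)
    case empty
    \<comment> \<open>The empty set is a transversal of the empty family, so the hypothesis fails
      here.\<close>
    then show ?case by (metis card.empty empty_iff finite.emptyI le0)
  next
    case (insert A G)
    show ?case
    proof (cases "\<exists>T. finite T \<and> card T \<le> k \<and> (\<forall>A\<in>G. A \<inter> T \<noteq> {})")
      case False
      then have "\<exists>S F. finite S \<and> card S = k + 1 \<and> (\<forall>t\<in>S. F t \<in> G \<and> F t \<inter> S = {t})"
        using insert.IH insert.prems(1) by simp
      then show ?thesis by blast
    next
      case True
      then obtain T where T: "finite T" "card T \<le> k" "\<forall>A\<in>G. A \<inter> T \<noteq> {}" by blast
      obtain a where a: "a \<in> A" using insert.prems(1) by auto
      \<comment> \<open>\<open>S\<close> meets every set in \<open>insert A G\<close>, where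
        \<open>k\<close> points do not suffice. Hence it has exactly \<open>k + 1\<close> points,
        and dropping any \<open>t\<close> misses some member, which then meets \<open>S\<close> in
        \<open>t\<close> alone.\<close>
      define S where "S = insert a T"
      have S: "finite S" "card S \<le> k + 1" "\<forall>C\<in>insert A G. C \<inter> S \<noteq> {}"
        using T a by (auto simp: S_def card_insert_if)
      have card_S: "card S = k + 1"
        using S insert.prems(2) by (metis Suc_eq_plus1 le_Suc_eq)
      have "\<exists>C\<in>insert A G. C \<inter> S = {t}" if "t \<in> S" for t
      proof -
        have "finite (S - {t})" "card (S - {t}) \<le> k"
          using S(1) card_S that by auto
        then have "\<not> (\<forall>C\<in>insert A G. C \<inter> (S - {t}) \<noteq> {})"
          using insert.prems(2) by metis
        then obtain C where "C \<in> insert A G" "C \<inter> (S - {t}) = {}" by metis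
        moreover have "C \<inter> S \<noteq> {}" using S(3) \<open>C \<in> insert A G\<close> by blast
        ultimately show ?thesis by blast
      qed
      then obtain F where "\<forall>t\<in>S. F t \<in> insert A G \<and> F t \<inter> S = {t}" by metis
      then show ?thesis using S(1) card_S by blast
    qed
  qed
  then show ?thesis using that by blast
qed

text \<open>(Q) returns a sub-multiset of possibly repeated sets; this recovers the indices behind
  it. A sub-multiset of \<open>mset_set S\<close> has multiplicities at most one, so it is again a
  set.\<close>

lemma subseteq_image_mset_setE:
  assumes "finite S" "M \<subseteq># image_mset f (mset_set S)"
  obtains S' where "S' \<subseteq> S" "M = image_mset f (mset_set S')"
proof -
  obtain N N' where N: "mset_set S = N + N'" "M = image_mset f N"
    using assms(2) by (metis image_mset_eq_plusD subset_mset.le_iff_add)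
  have "count N t \<le> 1" for t
    using N(1) count_mset_set'[of S t] by (metis count_union le_add1 le_trans le_refl zero_le_one)
  then have "count N t = count (mset_set (set_mset N)) t" for t
    by (auto simp: count_mset_set' not_in_iff le_antisym Suc_leI)
  then have "N = mset_set (set_mset N)"
    by (simp add: multiset_eq_iff)
  moreover have "set_mset N \<subseteq> S"
    using N(1) assms(1) by (metis Un_upper1 finite_set_mset_mset_set set_mset_union)
  ultimately show ?thesis using N(2) that by metis
qed

lemma union_of_private_sets:
  fixes F :: "nat \<Rightarrow> nat set"
  assumes "statement_Q" "finite V" "card V \<le> 2 * k"
    and "S \<subseteq> V" "card S = k + 1" "\<forall>t\<in>S. F t \<subseteq> V \<and> F t \<inter> S = {t}"
  obtains S' where "S' \<subseteq> S" "card (\<Union> (F ` S')) = k"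
proof -
  define R where "R = (\<lambda>t. F t - S)"
  define M where "M = image_mset R (mset_set S)"
  have fin: "finite S" using assms(2,4) finite_subset by blast
  have U: "\<Union> (set_mset M) \<subseteq> V - S"
    using assms(6) fin by (auto simp: M_def R_def)
  \<comment> \<open>The bound is at most \<open>k - 1\<close> because
    \<open>card V \<le> 2 * k\<close>, so the \<open>k + 1\<close> sets \<open>R t\<close>, counted
    with multiplicity, just exceed the threshold in (Q).\<close>
  then have "card (\<Union> (set_mset M)) \<le> card V - (k + 1)"
    by (metis assms(2,4,5) card_Diff_subset card_mono fin finite_Diff)
  moreover have "k + 1 \<le> card V" using assms(2,4,5) card_mono by metis
  moreover have "size M = k + 1" using fin assms(5) by (simp add: M_def)
  ultimately have "card (\<Union> (set_mset M)) + 1 < size M" using assms(3) by linarith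
  moreover have "\<forall>C\<in>#M. finite C"
    using U assms(2) by (meson Sup_upper finite_Diff finite_subset)
  ultimately obtain M' where M': "M' \<subset># M" "size M - size M' = card (\<Union> (set_mset M')) + 1"
    using assms(1) unfolding statement_Q_def by blast
  obtain S' where S': "S' \<subseteq> S" "M' = image_mset R (mset_set S')"
    using subseteq_image_mset_setE[OF fin, of M' R] M'(1)
    by (auto simp: M_def subset_mset_def)
  have fin': "finite S'" using S'(1) fin finite_subset by blast
  have sub: "\<Union> (R ` S') \<subseteq> V - S" using S'(1) assms(6) by (auto simp: R_def)
  have "F t = insert t (R t)" if "t \<in> S'" for t
    using that S'(1) assms(6) by (auto simp: R_def)
  then have "\<Union> (F ` S') = S' \<union> \<Union> (R ` S')" by auto
  moreover have "card (S' \<union> \<Union> (R ` S')) = card S' + card (\<Union> (R ` S'))"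
  proof (rule card_Un_disjoint)
    show "finite (\<Union> (R ` S'))" using sub assms(2) by (meson finite_Diff finite_subset)
  qed (use fin' sub S'(1) in auto)
  moreover have "k + 1 - card S' = card (\<Union> (R ` S')) + 1"
    using M'(2) S'(2) \<open>size M = k + 1\<close> fin' by simp
  ultimately have "card (\<Union> (F ` S')) = k" by simp
  then show ?thesis using that S'(1) by blast
qed

lemma union_closed_Union:
  assumes "union_closed \<A>" "finite \<C>" "\<C> \<noteq> {}" "\<C> \<subseteq> \<A>"
  shows "\<Union> \<C> \<in> \<A>"
  using assms(2-4)
proof (induction rule: finite_ne_induct)
  case (insert A \<C>)
  then show ?case using assms(1) by (simp add: union_closed_def)
qed simp

lemma card_avoiding_le_containing:
  assumes "union_closed \<A>" "B \<in> \<A>"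
  shows "card (members_avoiding \<A> B) \<le> card (members_containing \<A> B)"
proof (rule card_inj_on_le[where f = "\<lambda>A. A \<union> B"])
  \<comment> \<open>A set \<open>A\<close> disjoint from \<open>B\<close> is recovered as
    \<open>(A \<union> B) - B\<close>.\<close>
  show "inj_on (\<lambda>A. A \<union> B) (members_avoiding \<A> B)"
    by (auto simp: inj_on_def members_avoiding_def)
  show "(\<lambda>A. A \<union> B) ` members_avoiding \<A> B \<subseteq> members_containing \<A> B"
    using assms by (auto simp: union_closed_def members_avoiding_def members_containing_def)
  show "finite (members_containing \<A> B)"
    using assms by (simp add: union_closed_def members_containing_def)
qed

theorem proposition2p3:
  fixes \<A> :: "nat set set" and n x :: nat
  assumes "statement_Q"
    and "union_closed \<A>"
    and "\<Union>\<A> = {1..n}"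
    and "x \<in> {1..n div 2 + 1}"
  shows "\<exists>B. B \<subseteq> {1..n} \<and> card B = n - x + 1 \<and>
           card (members_containing \<A> B) \<ge> card (members_avoiding \<A> B)"
proof -
  define k where "k = n - x + 1"
  define G where "G = \<A> - {{}}"
  have \<A>: "finite \<A>" "\<A> \<noteq> {}" using assms(2) by (auto simp: union_closed_def)
  have top: "{1..n} \<in> \<A>"
    using union_closed_Union[OF assms(2) \<A>] assms(3) by simp
  have "n \<noteq> 0" using assms(2,3) by (auto simp: union_closed_def)
  \<comment> \<open>The upper bound on \<open>x\<close> gives \<open>k \<ge> n - n div 2\<close>,
    hence \<open>n \<le> 2 * k\<close>, the room needed to apply (Q).\<close>
  then have k: "k \<le> n" "n \<le> 2 * k" "1 \<le> k" using assms(4) by (auto simp: k_def)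
  show ?thesis
  proof (cases "\<exists>B\<subseteq>{1..n}. card B = k \<and> (\<forall>A\<in>G. A \<inter> B \<noteq> {})")
    case True
    then obtain B where B: "B \<subseteq> {1..n}" "card B = k" "\<forall>A\<in>G. A \<inter> B \<noteq> {}" by blast
    have "members_avoiding \<A> B \<subseteq> {{}}"
      using B(3) by (auto simp: members_avoiding_def G_def)
    then have "card (members_avoiding \<A> B) \<le> 1"
      by (metis card.empty card_mono card_insert_if empty_iff finite.emptyI finite_insert One_nat_def)
    moreover have "{1..n} \<in> members_containing \<A> B" "finite (members_containing \<A> B)"
      using top B(1) \<A>(1) by (auto simp: members_containing_def)
    then have "card (members_containing \<A> B) \<ge> 1"
      by (metis One_nat_def Suc_leI card_gt_0_iff empty_iff)
    ultimately have "card (members_avoiding \<A> B) \<le> card (members_containing \<A> B)" by linarith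
    then show ?thesis using B(1,2) unfolding k_def by blast
  next
    case False
    \<comment> \<open>The case assumption concerns only \<open>k\<close>-subsets of
      \<open>{1..n}\<close>. A smaller transversal, or one with points outside, is cut down to
      \<open>{1..n}\<close> and padded to size \<open>k\<close>.\<close>
    have no_transversal: "\<nexists>T. finite T \<and> card T \<le> k \<and> (\<forall>A\<in>G. A \<inter> T \<noteq> {})"
    proof
      assume "\<exists>T. finite T \<and> card T \<le> k \<and> (\<forall>A\<in>G. A \<inter> T \<noteq> {})"
      then obtain T where T: "finite T" "card T \<le> k" "\<forall>A\<in>G. A \<inter> T \<noteq> {}" by blast
      have "card (T \<inter> {1..n}) \<le> k" using T(1,2) by (meson Int_lower1 card_mono le_trans)
      then obtain B where B: "T \<inter> {1..n} \<subseteq> B" "B \<subseteq> {1..n}" "card B = k"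
        using exists_subset_between[of "T \<inter> {1..n}" k "{1..n}"] k(1) by auto
      have "A \<inter> B \<noteq> {}" if "A \<in> G" for A
      proof -
        have "A \<subseteq> {1..n}" using that assms(3) by (auto simp: G_def)
        then show ?thesis using T(3) that B(1) by blast
      qed
      then show False using False B(2,3) by blast
    qed
    have "finite G" "\<forall>A\<in>G. A \<noteq> {}" using \<A>(1) by (simp_all add: G_def)
    then obtain S F where S: "card S = k + 1" "\<forall>t\<in>S. F t \<in> G \<and> F t \<inter> S = {t}"
      using critical_transversal no_transversal by metis
    have F: "F t \<subseteq> {1..n}" if "t \<in> S" for t
      using S(2) that assms(3) by (auto simp: G_def)
    have "S \<subseteq> {1..n}" using F S(2) by blast
    then obtain S' where S': "S' \<subseteq> S" "card (\<Union> (F ` S')) = k"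
      using union_of_private_sets[of "{1..n}" k S F] assms(1) k(2) S F by auto
    \<comment> \<open>An empty \<open>S'\<close> would give the empty union, which need not be a
      member of \<open>\<A>\<close>; \<open>1 \<le> k\<close> excludes it.\<close>
    have "S' \<noteq> {}" using S'(2) k(3) by auto
    moreover have "finite S'" using S'(1) \<open>S \<subseteq> {1..n}\<close> by (meson finite_atLeastAtMost finite_subset)
    moreover have "F ` S' \<subseteq> \<A>" using S(2) S'(1) by (auto simp: G_def)
    ultimately have "\<Union> (F ` S') \<in> \<A>" using union_closed_Union[OF assms(2)] by simp
    moreover have "\<Union> (F ` S') \<subseteq> {1..n}" using S'(1) F by blast
    ultimately show ?thesis
      using card_avoiding_le_containing[OF assms(2)] S'(2) unfolding k_def by blast
  qed
qed

end
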